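(* Fix an integer $k\ge 1$. For each $n$, let $M=M^{(n)}$ be the number of matches in a uniformly randomly arranged deck with $k$ suits and $n$ ranks. As $n\to\infty$ the distribution of $M$ converges to a Poisson distribution with parameter $\lambda=k-1$. That is, for every integer $r\ge 0$, $$\lim_{n\to\infty}\mathrm{P}(M=r)=e^{-(k-1)}\frac{(k-1)^r}{r!}.$$
   Context: The deck has $kn$ distinct cards, one for each pair (suit, rank) with $k$ suits and $n$ ranks; all $(kn)!$ orderings are equally likely. $M$ is the number of indices $i$, $1\le i\le kn-1$, such that the cards in positions $i$ and $i+1$ have the same rank. For $k=1$ the Poisson distribution with parameter $0$ is the point mass at $0$, with the convention $0^0=1$. *)

theory Defs
  imports "HOL-Probability.Probability" "HOL-Combinatorics.Multiset_Permutations"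
begin

(* A card is a pair (suit, rank). *)
type_synonym card = "nat \<times> nat"

definition deck :: "nat \<Rightarrow> nat \<Rightarrow> card set" where
  "deck k n = {1..k} \<times> {1..n}"

(* A deck arrangement is a list without repetitions whose elements are exactly the cards. *)
definition shuffled_deck :: "nat \<Rightarrow> nat \<Rightarrow> card list pmf" where
  "shuffled_deck k n = pmf_of_set (permutations_of_set (deck k n))"

(* List positions count from 0, so positions i and i + 1 of the deck, for 1 \<le> i \<le> kn - 1,
   are list indices i - 1 and i. *)
definition matches :: "card list \<Rightarrow> nat" where
  "matches xs = card {i. Suc i < length xs \<and> snd (xs ! i) = snd (xs ! Suc i)}"

end

theory Submission
  imports Defs
begin

text \<open>
  The proof is a size-bias argument. Write \<open>N = k n\<close> for the number of cards and \<open>M\<close> for the number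
  of matches. Deleting a fixed card \<open>b\<close> from the deck and remembering its position is a bijection
  from the arrangements of the deck to pairs of an arrangement of \<open>N - 1\<close> cards and one of \<open>N\<close>
  insertion positions (\<open>bij_betw_insert_at\<close>). This bijection is used twice.

  First, inserting \<open>b\<close> directly behind a card of its own rank raises the number of matches by
  exactly one, even when this separates two matching cards, and there are \<open>k - 1\<close> such places.
  Counting the matches of an arrangement by their second card \<open>b\<close> therefore gives an exact identity
  between the deck and the decks with one card removed (\<open>sum_matches_size_bias\<close>). For the
  constant function it says \<open>E M = k - 1\<close>; for the indicator of \<open>s + 1\<close> it says that
  \<open>(s + 1) P(M = s + 1)\<close> is \<open>k - 1\<close> times the probability of \<open>s\<close> matches after the removal of a
  uniformly chosen card.

  Secondly, inserting \<open>b\<close> at a typical place changes nothing: only the at most \<open>2 (k - 1)\<close> places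
  next to a card of the same rank, and the places inside an existing match, matter. So the removal
  of a card changes \<open>P(M = s)\<close> by \<open>O(1/N)\<close> only (\<open>abs_card_matches_delete_le\<close>).

  Together, \<open>(s + 1) P(M = s + 1) - (k - 1) P(M = s) \<rightarrow> 0\<close> for every \<open>s\<close>. This is the recursion
  of the Poisson weights, and it determines the limit up to a constant factor. Since \<open>E M\<close> is
  bounded, Markov's inequality prevents mass from escaping to infinity, which fixes the factor
  (\<open>tendsto_poisson_of_recursion\<close>).
\<close>

section \<open>Removing and inserting a card\<close>

definition insert_at :: "nat \<Rightarrow> 'a \<Rightarrow> 'a list \<Rightarrow> 'a list" where
  "insert_at p b ys = take p ys @ b # drop p ys"

lemma card_eq_Suc_length_permutation_delete:
  assumes "finite A" "b \<in> A" "ys \<in> permutations_of_set (A - {b})"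
  shows "card A = Suc (length ys)"
  using length_finite_permutations_of_set[OF assms(3)] card_Suc_Diff1[OF assms(1,2)] by metis

lemma bij_betw_insert_at:
  assumes "finite A" "b \<in> A"
  shows "bij_betw (\<lambda>(ys, p). insert_at p b ys)
           (permutations_of_set (A - {b}) \<times> {..<card A}) (permutations_of_set A)"
proof (rule bij_betwI')
  fix x assume x: "x \<in> permutations_of_set (A - {b}) \<times> {..<card A}"
  obtain ys p where ys: "x = (ys, p)" by fastforce
  have p: "p \<le> length ys" "b \<notin> set ys" "set ys = A - {b}" "distinct ys"
    using x card_eq_Suc_length_permutation_delete[OF assms, of ys]
    by (auto simp: ys permutations_of_set_def)
  have "set (insert_at p b ys) = insert b (set (take p ys) \<union> set (drop p ys))"
    by (auto simp: insert_at_def)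
  also have "\<dots> = insert b (set ys)"
    by (metis append_take_drop_id set_append)
  also have "\<dots> = A" using p assms by auto
  finally have s: "set (insert_at p b ys) = A" .
  have "distinct (take p ys @ drop p ys)" using p by simp
  then have "distinct (insert_at p b ys)"
    using p(2) by (auto simp: insert_at_def simp del: append_take_drop_id dest: in_set_takeD in_set_dropD)
  with s show "(case x of (ys, p) \<Rightarrow> insert_at p b ys) \<in> permutations_of_set A"
    by (simp add: ys permutations_of_set_def)
  fix y assume y: "y \<in> permutations_of_set (A - {b}) \<times> {..<card A}"
  obtain zs q where zs: "y = (zs, q)" by fastforce
  have q: "q \<le> length zs" "b \<notin> set zs"
    using y card_eq_Suc_length_permutation_delete[OF assms, of zs]
    by (auto simp: zs permutations_of_set_def)
  show "((case x of (ys, p) \<Rightarrow> insert_at p b ys) = (case y of (ys, p) \<Rightarrow> insert_at p b ys)) = (x = y)"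
  proof
    assume "(case x of (ys, p) \<Rightarrow> insert_at p b ys) = (case y of (ys, p) \<Rightarrow> insert_at p b ys)"
    then have "take p ys @ b # drop p ys = take q zs @ b # drop q zs"
      by (simp add: ys zs insert_at_def)
    then have e: "take p ys = take q zs" "drop p ys = drop q zs"
      using append_Cons_eq_iff[of b "take p ys" "drop p ys" "take q zs" "drop q zs"] p(2) q(2)
      by (auto dest: in_set_takeD in_set_dropD)
    have "ys = zs" using e by (metis append_take_drop_id)
    moreover have "p = q" using arg_cong[OF e(1), of length] p q by simp
    ultimately show "x = y" by (simp add: ys zs)
  qed simp
next
  fix xs assume xs: "xs \<in> permutations_of_set A"
  then have "b \<in> set xs" using assms by (simp add: permutations_of_set_def)
  then obtain us vs where uv: "xs = us @ b # vs" by (meson split_list)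
  have "us @ vs \<in> permutations_of_set (A - {b})"
    using xs uv by (auto simp: permutations_of_set_def)
  moreover have "length us < card A"
    using length_finite_permutations_of_set[OF xs] uv by simp
  ultimately show "\<exists>x\<in>permutations_of_set (A - {b}) \<times> {..<card A}.
      xs = (case x of (ys, p) \<Rightarrow> insert_at p b ys)"
    by (intro bexI[of _ "(us @ vs, length us)"]) (auto simp: insert_at_def uv)
qed

lemma sum_permutations_insert_at:
  assumes "finite A" "b \<in> A"
  shows "(\<Sum>xs\<in>permutations_of_set A. f xs) =
         (\<Sum>ys\<in>permutations_of_set (A - {b}). \<Sum>p<card A. f (insert_at p b ys))"
  unfolding sum.cartesian_product
  by (subst sum.reindex_bij_betw[OF bij_betw_insert_at[OF assms], symmetric])
    (simp add: case_prod_unfold)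

section \<open>The effect of an insertion on the number of matches\<close>

text \<open>
  A match created where two sublists meet. The requirement that both be nonempty lets the two ends
  of the deck be treated like all other places.
\<close>

definition junction :: "card list \<Rightarrow> card list \<Rightarrow> bool" where
  "junction us vs \<longleftrightarrow> us \<noteq> [] \<and> vs \<noteq> [] \<and> snd (last us) = snd (hd vs)"

lemma junction_Nil [simp]: "\<not> junction [] vs"
  by (simp add: junction_def)

lemma junction_take:
  assumes "p \<le> length ys"
  shows "junction (take p ys) vs \<longleftrightarrow> 0 < p \<and> vs \<noteq> [] \<and> snd (ys ! (p - 1)) = snd (hd vs)"
  using assms by (cases p) (auto simp: junction_def take_Suc_conv_app_nth)

lemma finite_match_set: "finite {i. Suc i < length xs \<and> P i}"
  by (rule finite_subset[of _ "{..<length xs}"]) auto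

lemma matches_Cons:
  "matches (x # xs) = of_bool (junction [x] xs) + matches xs"
proof -
  let ?S = "\<lambda>xs::card list. {i. Suc i < length xs \<and> snd (xs ! i) = snd (xs ! Suc i)}"
  have "i \<in> ?S (x # xs) \<longleftrightarrow> i \<in> (if junction [x] xs then {0} else {}) \<union> Suc ` ?S xs" for i
    by (cases i; cases xs) (auto simp: junction_def image_iff)
  then have "?S (x # xs) = (if junction [x] xs then {0} else {}) \<union> Suc ` ?S xs"
    by blast
  then have "matches (x # xs) = card ((if junction [x] xs then {0} else {}) \<union> Suc ` ?S xs)"
    unfolding matches_def by (rule arg_cong)
  also have "\<dots> = of_bool (junction [x] xs) + card (Suc ` ?S xs)"
    by (subst card_Un_disjoint) (auto simp: finite_match_set)
  also have "card (Suc ` ?S xs) = matches xs"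
    by (simp add: matches_def card_image)
  finally show ?thesis .
qed

lemma matches_append:
  "matches (us @ vs) = matches us + matches vs + of_bool (junction us vs)"
proof (induction us)
  case Nil
  show ?case by (simp add: matches_def junction_def)
next
  case (Cons x us)
  show ?case
  proof (cases "us = []")
    case True
    then show ?thesis by (simp add: matches_Cons matches_def[of "[]"]) (simp add: junction_def)
  next
    case False
    then have "junction [x] (us @ vs) = junction [x] us" "junction (x # us) vs = junction us vs"
      by (auto simp: junction_def)
    with Cons show ?thesis by (simp add: matches_Cons)
  qed
qed

text \<open>
  Inserting \<open>b\<close> replaces the one junction at \<open>p\<close> by two new ones. The lost junction stands on the
  left-hand side so that no subtraction of natural numbers occurs.
\<close>

lemma matches_insert_at:
  "matches (insert_at p b ys) + of_bool (junction (take p ys) (drop p ys)) =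
   matches ys + of_bool (junction (take p ys) [b]) + of_bool (junction [b] (drop p ys))"
  using matches_append[of "take p ys" "drop p ys"]
  by (simp add: insert_at_def matches_append matches_Cons)
    (simp add: junction_def)

text \<open>
  If the next card also had the rank of \<open>b\<close>, then the match that is split is replaced by two;
  otherwise no match is split and only the one before \<open>b\<close> is new.
\<close>

lemma matches_insert_at_after_match:
  assumes "junction (take p ys) [b]"
  shows "matches (insert_at p b ys) = Suc (matches ys)"
proof -
  have "junction [b] (drop p ys) \<longleftrightarrow> junction (take p ys) (drop p ys)"
    using assms by (auto simp: junction_def)
  then show ?thesis using matches_insert_at[of p b ys] assms by auto
qed

definition follows_match :: "card \<Rightarrow> card list \<Rightarrow> bool" where
  "follows_match b xs \<longleftrightarrow> (\<exists>i. Suc i < length xs \<and> xs ! Suc i = b \<and> snd (xs ! i) = snd b)"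

text \<open>
  In a list of distinct cards a match is determined by its second card. Counting matches by
  cards instead of positions makes it possible to exchange the sum over matches with the sum over
  arrangements.
\<close>

lemma matches_eq_card_follows_match:
  assumes "distinct xs"
  shows "matches xs = card {b \<in> set xs. follows_match b xs}"
proof -
  let ?S = "{i. Suc i < length xs \<and> snd (xs ! i) = snd (xs ! Suc i)}"
  have "{b \<in> set xs. follows_match b xs} = (\<lambda>i. xs ! Suc i) ` ?S"
  proof (intro set_eqI iffI)
    fix b assume "b \<in> {b \<in> set xs. follows_match b xs}"
    then obtain i where "Suc i < length xs" "xs ! Suc i = b" "snd (xs ! i) = snd b"
      by (auto simp: follows_match_def)
    then show "b \<in> (\<lambda>i. xs ! Suc i) ` ?S" by (intro image_eqI[of _ _ i]) simp_all
  next
    fix b assume "b \<in> (\<lambda>i. xs ! Suc i) ` ?S"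
    then obtain i where "Suc i < length xs" "b = xs ! Suc i" "snd (xs ! i) = snd (xs ! Suc i)"
      by blast
    then show "b \<in> {b \<in> set xs. follows_match b xs}"
      by (auto simp: follows_match_def)
  qed
  moreover have "inj_on (\<lambda>i. xs ! Suc i) ?S"
    using assms by (auto simp: inj_on_def nth_eq_iff_index_eq)
  ultimately show ?thesis by (simp add: card_image matches_def)
qed

lemma follows_match_insert_at:
  assumes "b \<notin> set ys" "p \<le> length ys"
  shows "follows_match b (insert_at p b ys) \<longleftrightarrow> junction (take p ys) [b]"
proof
  let ?xs = "insert_at p b ys"
  assume "follows_match b ?xs"
  then obtain i where i: "Suc i < length ?xs" "?xs ! Suc i = b" "snd (?xs ! i) = snd b"
    by (auto simp: follows_match_def)
  have "p = Suc i"
  proof (rule ccontr)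
    assume "p \<noteq> Suc i"
    then have "?xs ! Suc i \<in> set ys"
      using i(1) assms(2)
      by (cases "Suc i < p") (auto simp: insert_at_def nth_append nth_Cons' )
    with i assms show False by simp
  qed
  then show "junction (take p ys) [b]"
    using i assms by (simp add: junction_take insert_at_def nth_append)
next
  assume "junction (take p ys) [b]"
  then obtain i where "p = Suc i" "snd (ys ! i) = snd b"
    using assms(2) by (cases p) (auto simp: junction_take)
  then show "follows_match b (insert_at p b ys)"
    unfolding follows_match_def
    by (intro exI[of _ i]) (use assms in \<open>simp add: insert_at_def nth_append\<close>)
qed

section \<open>Counting the insertion positions\<close>

lemma card_index_same_rank:
  assumes "finite A" "b \<in> A" "card {a \<in> A. snd a = snd b} = k" "ys \<in> permutations_of_set (A - {b})"
  shows "card {i. i < length ys \<and> snd (ys ! i) = snd b} = k - 1"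
proof -
  let ?I = "{i. i < length ys \<and> snd (ys ! i) = snd b}"
  have ys: "set ys = A - {b}" "distinct ys"
    using assms(4) by (auto simp: permutations_of_set_def)
  have "(\<lambda>i. ys ! i) ` ?I = {a \<in> set ys. snd a = snd b}"
    unfolding set_conv_nth by blast
  also have "\<dots> = {a \<in> A. snd a = snd b} - {b}" using ys by auto
  finally have "card ((\<lambda>i. ys ! i) ` ?I) = k - 1" using assms by simp
  moreover have "inj_on (\<lambda>i. ys ! i) ?I"
    using ys by (auto simp: inj_on_def nth_eq_iff_index_eq)
  ultimately show ?thesis by (simp add: card_image)
qed

lemma card_junction_before:
  "card {p. p \<le> length ys \<and> junction (take p ys) [b]} = card {i. i < length ys \<and> snd (ys ! i) = snd b}"
proof -
  have "p \<in> {p. p \<le> length ys \<and> junction (take p ys) [b]} \<longleftrightarrow>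
        p \<in> Suc ` {i. i < length ys \<and> snd (ys ! i) = snd b}" for p
    by (cases p) (auto simp: junction_take)
  then have "{p. p \<le> length ys \<and> junction (take p ys) [b]} =
        Suc ` {i. i < length ys \<and> snd (ys ! i) = snd b}" by blast
  then show ?thesis by (simp add: card_image)
qed

lemma card_junction_after:
  "card {p. p \<le> length ys \<and> junction [b] (drop p ys)} = card {i. i < length ys \<and> snd (ys ! i) = snd b}"
  by (rule arg_cong[where f = card]) (auto simp: junction_def hd_drop_conv_nth)

lemma card_junction_between:
  "card {p. p \<le> length ys \<and> junction (take p ys) (drop p ys)} = matches ys"
proof -
  have "p \<in> {p. p \<le> length ys \<and> junction (take p ys) (drop p ys)} \<longleftrightarrow>
        p \<in> Suc ` {i. Suc i < length ys \<and> snd (ys ! i) = snd (ys ! Suc i)}" for p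
    by (cases p) (auto simp: junction_take hd_drop_conv_nth)
  then have "{p. p \<le> length ys \<and> junction (take p ys) (drop p ys)} =
        Suc ` {i. Suc i < length ys \<and> snd (ys ! i) = snd (ys ! Suc i)}" by blast
  then show ?thesis by (simp add: card_image matches_def)
qed

text \<open>
  By the balance in \<open>matches_insert_at\<close>, a position that changes the number of matches has one
  of the three junctions: before \<open>b\<close>, after \<open>b\<close>, or between the cards that \<open>b\<close> separates.
\<close>

lemma card_insert_at_changes_matches:
  "card {p. p \<le> length ys \<and> matches (insert_at p b ys) \<noteq> matches ys}
   \<le> 2 * card {i. i < length ys \<and> snd (ys ! i) = snd b} + matches ys"
proof -
  let ?B = "{p. p \<le> length ys \<and> junction (take p ys) [b]}"
  let ?C = "{p. p \<le> length ys \<and> junction [b] (drop p ys)}"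
  let ?D = "{p. p \<le> length ys \<and> junction (take p ys) (drop p ys)}"
  have "{p. p \<le> length ys \<and> matches (insert_at p b ys) \<noteq> matches ys} \<subseteq> ?B \<union> ?C \<union> ?D"
  proof
    fix p assume p: "p \<in> {p. p \<le> length ys \<and> matches (insert_at p b ys) \<noteq> matches ys}"
    then show "p \<in> ?B \<union> ?C \<union> ?D"
      using matches_insert_at[of p b ys] by (auto intro: ccontr)
  qed
  then have "card {p. p \<le> length ys \<and> matches (insert_at p b ys) \<noteq> matches ys} \<le> card (?B \<union> ?C \<union> ?D)"
    by (intro card_mono) auto
  also have "\<dots> \<le> card ?B + card ?C + card ?D"
    by (meson card_Un_le add_mono order_trans order_refl)
  finally show ?thesis
    by (simp only: card_junction_before card_junction_after card_junction_between mult_2)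
qed

section \<open>The size-bias identity and the approximate recursion\<close>

text \<open>
  The weight \<open>M\<close> counts the cards \<open>b\<close> that complete a match. For fixed \<open>b\<close>, the arrangements in
  which \<open>b\<close> does so arise from each arrangement \<open>ys\<close> of the other cards by inserting \<open>b\<close> behind one
  of the \<open>k - 1\<close> cards of its rank, and all of them have \<open>matches ys + 1\<close> matches. The test
  function \<open>g\<close> is kept general because both the mean and the recursion are instances.
\<close>

lemma sum_matches_size_bias:
  fixes g :: "nat \<Rightarrow> real"
  assumes "finite A" "\<And>b. b \<in> A \<Longrightarrow> card {a \<in> A. snd a = snd b} = k"
  shows "(\<Sum>xs\<in>permutations_of_set A. real (matches xs) * g (matches xs)) =
         real (k - 1) * (\<Sum>b\<in>A. \<Sum>ys\<in>permutations_of_set (A - {b}). g (Suc (matches ys)))"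
proof -
  have "(\<Sum>xs\<in>permutations_of_set A. real (matches xs) * g (matches xs)) =
        (\<Sum>xs\<in>permutations_of_set A. \<Sum>b\<in>A. of_bool (follows_match b xs) * g (matches xs))"
  proof (rule sum.cong[OF refl])
    fix xs assume "xs \<in> permutations_of_set A"
    then have xs: "set xs = A" "distinct xs" by (auto simp: permutations_of_set_def)
    have "real (matches xs) = (\<Sum>b\<in>A. of_bool (follows_match b xs))"
      using assms(1) xs by (simp add: matches_eq_card_follows_match Int_def)
    then show "real (matches xs) * g (matches xs) = (\<Sum>b\<in>A. of_bool (follows_match b xs) * g (matches xs))"
      by (simp add: sum_distrib_right)
  qed
  also have "\<dots> = (\<Sum>b\<in>A. \<Sum>xs\<in>permutations_of_set A. of_bool (follows_match b xs) * g (matches xs))"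
    by (rule sum.swap)
  also have "\<dots> = (\<Sum>b\<in>A. \<Sum>ys\<in>permutations_of_set (A - {b}). real (k - 1) * g (Suc (matches ys)))"
  proof (rule sum.cong[OF refl])
    fix b assume b: "b \<in> A"
    have "(\<Sum>xs\<in>permutations_of_set A. of_bool (follows_match b xs) * g (matches xs)) =
      (\<Sum>ys\<in>permutations_of_set (A - {b}). \<Sum>p<card A.
         of_bool (follows_match b (insert_at p b ys)) * g (matches (insert_at p b ys)))"
      by (rule sum_permutations_insert_at[OF assms(1) b])
    also have "\<dots> = (\<Sum>ys\<in>permutations_of_set (A - {b}). real (k - 1) * g (Suc (matches ys)))"
    proof (rule sum.cong[OF refl])
      fix ys assume ys: "ys \<in> permutations_of_set (A - {b})"
      have len: "card A = Suc (length ys)"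
        by (rule card_eq_Suc_length_permutation_delete[OF assms(1) b ys])
      then have positions: "{..<card A} = {..length ys}" by (simp add: lessThan_Suc_atMost)
      have bys: "b \<notin> set ys" using ys by (auto simp: permutations_of_set_def)
      have "(\<Sum>p<card A. of_bool (follows_match b (insert_at p b ys)) * g (matches (insert_at p b ys)))
          = (\<Sum>p<card A. of_bool (junction (take p ys) [b]) * g (Suc (matches ys)))"
        by (rule sum.cong[OF refl])
          (auto simp: len follows_match_insert_at[OF bys] matches_insert_at_after_match)
      also have "\<dots> = real (card {p. p \<le> length ys \<and> junction (take p ys) [b]}) * g (Suc (matches ys))"
        by (simp add: positions Int_def flip: sum_distrib_right)
      finally show "(\<Sum>p<card A. of_bool (follows_match b (insert_at p b ys)) * g (matches (insert_at p b ys)))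
          = real (k - 1) * g (Suc (matches ys))"
        by (simp only: card_junction_before card_index_same_rank[OF assms(1) b assms(2)[OF b] ys])
    qed
    finally show "(\<Sum>xs\<in>permutations_of_set A. of_bool (follows_match b xs) * g (matches xs)) =
      (\<Sum>ys\<in>permutations_of_set (A - {b}). real (k - 1) * g (Suc (matches ys)))" .
  qed
  finally show ?thesis by (simp add: sum_distrib_left)
qed

text \<open>
  The number of bad positions grows with \<open>matches ys\<close>, which has no bound independent of the deck.
  But an insertion destroys at most one match, so only those \<open>ys\<close> with at most \<open>s + 1\<close> matches can
  contribute, and the bound depends on \<open>s\<close> and \<open>k\<close> alone.
\<close>

lemma abs_sum_of_bool_insert_at_le:
  assumes "finite A" "b \<in> A" "card {a \<in> A. snd a = snd b} = k" "ys \<in> permutations_of_set (A - {b})"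
  shows "\<bar>(\<Sum>p<card A. of_bool (matches (insert_at p b ys) = s)) - real (card A) * of_bool (matches ys = s)\<bar>
         \<le> real (2 * (k - 1) + Suc s)"
proof -
  let ?E = "{p. p \<le> length ys \<and> matches (insert_at p b ys) \<noteq> matches ys}"
  have len: "card A = Suc (length ys)"
    by (rule card_eq_Suc_length_permutation_delete[OF assms(1,2,4)])
  then have positions: "{..<card A} = {..length ys}" by (simp add: lessThan_Suc_atMost)
  have dec: "matches ys \<le> Suc (matches (insert_at p b ys))" for p
    using matches_insert_at[of p b ys] by (simp add: of_bool_def split: if_splits)
  have "(\<Sum>p<card A. of_bool (matches (insert_at p b ys) = s)) - real (card A) * of_bool (matches ys = s)
      = (\<Sum>p<card A. of_bool (matches (insert_at p b ys) = s) - of_bool (matches ys = s))"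
    by (simp add: sum_subtractf)
  also have "\<bar>\<dots>\<bar> \<le> (\<Sum>p<card A. \<bar>of_bool (matches (insert_at p b ys) = s) - of_bool (matches ys = s)\<bar>)"
    by (rule sum_abs)
  also have "\<dots> \<le> (\<Sum>p<card A. of_bool (matches ys \<le> Suc s) * of_bool (p \<in> ?E))"
  proof (rule sum_mono)
    fix p assume "p \<in> {..<card A}"
    with dec[of p]
    show "\<bar>of_bool (matches (insert_at p b ys) = s) - of_bool (matches ys = s)\<bar>
         \<le> of_bool (matches ys \<le> Suc s) * (of_bool (p \<in> ?E) :: real)"
      by (auto simp: len)
  qed
  also have "\<dots> = of_bool (matches ys \<le> Suc s) * real (card ?E)"
    by (simp add: positions Int_def flip: sum_distrib_left)
  also have "\<dots> \<le> real (2 * (k - 1) + Suc s)"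
    using card_insert_at_changes_matches[of ys b] card_index_same_rank[OF assms] by auto
  finally show ?thesis .
qed

text \<open>
  Divided by the factorial of \<open>card A\<close>, this says that the probability of \<open>s\<close> matches changes by
  \<open>O(1 / card A)\<close> when \<open>b\<close> is removed.
\<close>

lemma abs_card_matches_delete_le:
  assumes "finite A" "b \<in> A" "card {a \<in> A. snd a = snd b} = k"
  shows "\<bar>real (card {xs \<in> permutations_of_set A. matches xs = s}) -
          real (card A) * real (card {ys \<in> permutations_of_set (A - {b}). matches ys = s})\<bar>
         \<le> real (2 * (k - 1) + Suc s) * fact (card A - 1)"
proof -
  let ?P = "permutations_of_set (A - {b})"
  have "real (card {xs \<in> permutations_of_set A. matches xs = s}) =
        (\<Sum>xs\<in>permutations_of_set A. of_bool (matches xs = s))"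
    using assms by (simp add: Int_def)
  also have "\<dots> = (\<Sum>ys\<in>?P. \<Sum>p<card A. of_bool (matches (insert_at p b ys) = s))"
    by (rule sum_permutations_insert_at[OF assms(1,2)])
  finally have 1: "real (card {xs \<in> permutations_of_set A. matches xs = s}) = \<dots>" .
  have 2: "real (card A) * real (card {ys \<in> ?P. matches ys = s}) =
        (\<Sum>ys\<in>?P. real (card A) * of_bool (matches ys = s))"
    using assms by (simp add: Int_def flip: sum_distrib_left)
  have "\<bar>\<Sum>ys\<in>?P. (\<Sum>p<card A. of_bool (matches (insert_at p b ys) = s)) - real (card A) * of_bool (matches ys = s)\<bar>
     \<le> (\<Sum>ys\<in>?P. real (2 * (k - 1) + Suc s))"
    by (rule order_trans[OF sum_abs sum_mono]) (rule abs_sum_of_bool_insert_at_le[OF assms])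
  also have "\<dots> = real (2 * (k - 1) + Suc s) * fact (card A - 1)"
    using assms by (simp add: card_permutations_of_set)
  finally show ?thesis unfolding 1 2 sum_subtractf .
qed

text \<open>The mean number of matches, from the size-bias identity for the constant function.\<close>

lemma sum_matches_permutations:
  assumes "finite A" "A \<noteq> {}" "\<And>b. b \<in> A \<Longrightarrow> card {a \<in> A. snd a = snd b} = k"
  shows "(\<Sum>xs\<in>permutations_of_set A. real (matches xs)) = real (k - 1) * fact (card A)"
proof -
  have "(\<Sum>xs\<in>permutations_of_set A. real (matches xs)) =
     real (k - 1) * (\<Sum>b\<in>A. \<Sum>ys\<in>permutations_of_set (A - {b}). 1)"
    using sum_matches_size_bias[OF assms(1,3), of "\<lambda>_. 1"] by simp
  also have "(\<Sum>b\<in>A. \<Sum>ys\<in>permutations_of_set (A - {b}). 1 :: real) = (\<Sum>b\<in>A. fact (card A - 1))"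
    using assms by (intro sum.cong) (auto simp: card_permutations_of_set)
  also have "\<dots> = fact (card A)"
    using assms by (simp add: fact_reduce[of "card A"] card_gt_0_iff)
  finally show ?thesis .
qed

text \<open>
  The size-bias identity expresses the left term through the decks with one card removed, and
  averaging \<open>abs_card_matches_delete_le\<close> over the removed card leads back to the full deck.
\<close>

lemma card_matches_recursion:
  assumes "finite A" "A \<noteq> {}" "\<And>b. b \<in> A \<Longrightarrow> card {a \<in> A. snd a = snd b} = k"
  defines "Q \<equiv> \<lambda>s. real (card {xs \<in> permutations_of_set A. matches xs = s})"
  shows "\<bar>real (Suc s) * Q (Suc s) - real (k - 1) * Q s\<bar>
         \<le> real (k - 1) * real (2 * (k - 1) + Suc s) * fact (card A - 1)"
proof -
  let ?N = "real (card A)" and ?c = "real (2 * (k - 1) + Suc s) * fact (card A - 1)"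
  define w where "w = (\<lambda>b. real (card {ys \<in> permutations_of_set (A - {b}). matches ys = s}))"
  have N: "?N > 0" using assms by (simp add: card_gt_0_iff)
  have "real (Suc s) * Q (Suc s) =
     (\<Sum>xs\<in>permutations_of_set A. real (Suc s) * of_bool (matches xs = Suc s))"
    using assms by (simp add: Q_def Int_def flip: sum_distrib_left)
  also have "\<dots> = (\<Sum>xs\<in>permutations_of_set A. real (matches xs) * of_bool (matches xs = Suc s))"
    by (rule sum.cong) auto
  also have "\<dots> = real (k - 1) * (\<Sum>b\<in>A. w b)"
    using sum_matches_size_bias[OF assms(1,3), of "\<lambda>m. of_bool (m = Suc s)"] assms(1)
    by (simp add: w_def Int_def)
  finally have 1: "real (Suc s) * Q (Suc s) = real (k - 1) * (\<Sum>b\<in>A. w b)" .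
  have "?N * \<bar>(\<Sum>b\<in>A. w b) - Q s\<bar> = \<bar>\<Sum>b\<in>A. Q s - ?N * w b\<bar>"
    by (simp add: sum_subtractf abs_mult abs_minus_commute
        flip: sum_distrib_left right_diff_distrib)
  also have "\<dots> \<le> (\<Sum>b\<in>A. ?c)"
    unfolding Q_def w_def
    by (rule order_trans[OF sum_abs sum_mono])
      (rule abs_card_matches_delete_le[OF assms(1) _ assms(3)])
  also have "\<dots> = ?N * ?c" by simp
  finally have "\<bar>(\<Sum>b\<in>A. w b) - Q s\<bar> \<le> ?c" using N by (simp only: mult_le_cancel_left_pos)
  then have "real (k - 1) * \<bar>(\<Sum>b\<in>A. w b) - Q s\<bar> \<le> real (k - 1) * ?c"
    by (rule mult_left_mono) simp
  then show ?thesis unfolding 1 by (simp only: abs_mult abs_of_nat mult.assoc flip: right_diff_distrib)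
qed

section \<open>Poisson convergence from an approximate recursion\<close>

text \<open>
  The recursion gives \<open>pmf (p n) r \<approx> (\<mu> ^ r / r!) pmf (p n) 0\<close> for each fixed \<open>r\<close>. Summing over
  \<open>r < R\<close>, the total mass \<open>1\<close> is approximately \<open>exp \<mu>\<close> times \<open>pmf (p n) 0\<close>, up to a tail that is
  small uniformly in large \<open>n\<close>. Hence \<open>pmf (p n) 0\<close> tends to \<open>exp (- \<mu>)\<close>.
\<close>

lemma tendsto_poisson_of_recursion:
  fixes p :: "nat \<Rightarrow> nat pmf" and \<mu> :: real
  assumes rec: "\<And>r. (\<lambda>n. real (Suc r) * pmf (p n) (Suc r) - \<mu> * pmf (p n) r) \<longlonglongrightarrow> 0"
    and tail: "\<And>R. R > 0 \<Longrightarrow> eventually (\<lambda>n. measure_pmf.prob (p n) {R..} \<le> C / real R) sequentially"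
  shows "(\<lambda>n. pmf (p n) r) \<longlonglongrightarrow> exp (- \<mu>) * \<mu> ^ r / fact r"
proof -
  have rel: "(\<lambda>n. pmf (p n) r - \<mu> ^ r / fact r * pmf (p n) 0) \<longlonglongrightarrow> 0" for r
  proof (induction r)
    case (Suc r)
    have "(\<lambda>n. ((real (Suc r) * pmf (p n) (Suc r) - \<mu> * pmf (p n) r) +
            \<mu> * (pmf (p n) r - \<mu> ^ r / fact r * pmf (p n) 0)) / real (Suc r))
          \<longlonglongrightarrow> (0 + \<mu> * 0) / real (Suc r)"
      by (intro tendsto_intros rec Suc) simp
    then show ?case by (simp add: field_simps del: of_nat_Suc)
  qed simp
  define S where "S = (\<lambda>R. \<Sum>r<R. \<mu> ^ r / fact r)"
  have S: "S \<longlonglongrightarrow> exp \<mu>"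
    using exp_converges[of \<mu>] by (simp add: S_def sums_def divide_inverse mult.commute)
  have sumrel: "(\<lambda>n. (\<Sum>r<R. pmf (p n) r) - S R * pmf (p n) 0) \<longlonglongrightarrow> 0" for R
    using tendsto_sum[of "{..<R}" "\<lambda>r n. pmf (p n) r - \<mu> ^ r / fact r * pmf (p n) 0" "\<lambda>_. 0", OF rel]
    by (simp add: S_def sum_subtractf sum_distrib_right)
  have compl: "1 - (\<Sum>r<R. pmf (p n) r) = measure_pmf.prob (p n) {R..}" for n R
  proof -
    have "{R..} = UNIV - {..<R}" by auto
    then have "measure_pmf.prob (p n) {R..} = 1 - measure_pmf.prob (p n) {..<R}"
      using measure_pmf.prob_compl[of "{..<R}" "p n"] by simp
    then show ?thesis by (simp add: measure_measure_pmf_finite)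
  qed
  \<comment> \<open>The error splits into the truncation of the exponential series, the error of the recursion
     below \<open>R\<close>, and the tail; \<open>R\<close> is chosen before \<open>n\<close>.\<close>
  have zero: "(\<lambda>n. exp \<mu> * pmf (p n) 0) \<longlonglongrightarrow> 1"
  proof (rule LIMSEQ_I)
    fix e :: real assume e: "e > 0"
    have "eventually (\<lambda>R. \<bar>S R - exp \<mu>\<bar> < e / 3) sequentially"
      using tendstoD[OF S, of "e / 3"] e by (simp add: dist_real_def)
    moreover have "(\<lambda>R. C / real R) \<longlonglongrightarrow> 0" by (rule lim_const_over_n)
    then have "eventually (\<lambda>R. \<bar>C / real R\<bar> < e / 3) sequentially"
      using tendstoD[of "\<lambda>R. C / real R" 0 sequentially "e / 3"] e by (simp add: dist_real_def)
    moreover note eventually_gt_at_top[of 0]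
    ultimately have "eventually (\<lambda>R. \<bar>S R - exp \<mu>\<bar> < e / 3 \<and> \<bar>C / real R\<bar> < e / 3 \<and> R > 0) sequentially"
      by eventually_elim auto
    from eventually_happens[OF this]
    obtain R where R: "\<bar>S R - exp \<mu>\<bar> < e / 3" "\<bar>C / real R\<bar> < e / 3" "R > 0"
      by auto
    have "eventually (\<lambda>n. \<bar>(\<Sum>r<R. pmf (p n) r) - S R * pmf (p n) 0\<bar> < e / 3) sequentially"
      using tendstoD[OF sumrel, of "e / 3" R] e by (simp add: dist_real_def)
    with tail[OF R(3)] have "eventually (\<lambda>n. \<bar>exp \<mu> * pmf (p n) 0 - 1\<bar> < e) sequentially"
    proof eventually_elim
      case (elim n)
      have "\<bar>(exp \<mu> - S R) * pmf (p n) 0\<bar> \<le> \<bar>exp \<mu> - S R\<bar> * 1"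
        unfolding abs_mult by (intro mult_left_mono) (auto simp: pmf_le_1)
      then have trunc: "\<bar>exp \<mu> * pmf (p n) 0 - S R * pmf (p n) 0\<bar> < e / 3"
        using R(1) by (simp add: left_diff_distrib abs_minus_commute)
      have "\<bar>(\<Sum>r<R. pmf (p n) r) - 1\<bar> = measure_pmf.prob (p n) {R..}"
        using compl[of n R] measure_nonneg[of "measure_pmf (p n)" "{R..}"] by linarith
      also have "\<dots> < e / 3" using elim(1) R(2) by linarith
      finally show ?case using elim(2) trunc by linarith
    qed
    then show "\<exists>no. \<forall>n\<ge>no. norm (exp \<mu> * pmf (p n) 0 - 1) < e"
      by (simp add: eventually_sequentially)
  qed
  have "(\<lambda>n. exp (- \<mu>) * (exp \<mu> * pmf (p n) 0)) \<longlonglongrightarrow> exp (- \<mu>) * 1"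
    by (intro tendsto_intros zero)
  then have z: "(\<lambda>n. pmf (p n) 0) \<longlonglongrightarrow> exp (- \<mu>)" by (simp add: exp_minus field_simps)
  have "(\<lambda>n. (pmf (p n) r - \<mu> ^ r / fact r * pmf (p n) 0) + \<mu> ^ r / fact r * pmf (p n) 0)
      \<longlonglongrightarrow> 0 + \<mu> ^ r / fact r * exp (- \<mu>)"
    by (intro tendsto_intros rel z)
  then show ?thesis by (simp add: mult.commute)
qed

section \<open>The shuffled deck\<close>

lemma finite_deck: "finite (deck k n)" by (simp add: deck_def)

lemma card_deck: "card (deck k n) = k * n" by (simp add: deck_def)

lemma card_deck_same_rank:
  assumes "b \<in> deck k n"
  shows "card {a \<in> deck k n. snd a = snd b} = k"
proof -
  have "{a \<in> deck k n. snd a = snd b} = {1..k} \<times> {snd b}"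
    using assms by (auto simp: deck_def)
  then show ?thesis by simp
qed

lemma prob_shuffled_deck:
  "measure_pmf.prob (shuffled_deck k n) {xs. P xs} =
   real (card {xs \<in> permutations_of_set (deck k n). P xs}) / fact (k * n)"
  by (simp add: shuffled_deck_def measure_pmf_of_set finite_deck card_deck
      card_permutations_of_set Int_def)

theorem corollary10:
  fixes k :: nat
  assumes "k \<ge> 1"
  shows "\<forall>r. (\<lambda>n. measure_pmf.prob (shuffled_deck k n) {xs. matches xs = r})
           \<longlonglongrightarrow> exp (- (real k - 1)) * (real k - 1) ^ r / fact r"
proof
  fix r
  define p where "p = (\<lambda>n. map_pmf matches (shuffled_deck k n))"
  have pmf_p: "pmf (p n) r = measure_pmf.prob (shuffled_deck k n) {xs. matches xs = r}" for n r
    by (simp add: p_def pmf_map vimage_def)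
  have k: "real k - 1 = real (k - 1)" using assms by (simp add: of_nat_diff)
  have deck_ne: "deck k n \<noteq> {}" if "n > 0" for n
    using that assms card_deck[of k n] by auto
  have "(\<lambda>n. pmf (p n) r) \<longlonglongrightarrow> exp (- real (k - 1)) * real (k - 1) ^ r / fact r"
  proof (rule tendsto_poisson_of_recursion[where C = "real (k - 1)"])
    fix r
    define c where "c = real (k - 1) * real (2 * (k - 1) + Suc r)"
    have bound: "\<bar>real (Suc r) * pmf (p n) (Suc r) - real (k - 1) * pmf (p n) r\<bar> \<le> c / real n"
      if n: "n > 0" for n
    proof -
      have N: "k * n > 0" using n assms by simp
      let ?Q = "\<lambda>s. real (card {xs \<in> permutations_of_set (deck k n). matches xs = s})"
      have "\<bar>real (Suc r) * pmf (p n) (Suc r) - real (k - 1) * pmf (p n) r\<bar> =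
            \<bar>real (Suc r) * ?Q (Suc r) - real (k - 1) * ?Q r\<bar> / fact (k * n)"
        unfolding pmf_p prob_shuffled_deck
        by (simp only: times_divide_eq_right diff_divide_distrib[symmetric] abs_divide
            abs_of_nonneg fact_ge_zero)
      also have "\<dots> \<le> c * fact (k * n - 1) / fact (k * n)"
        using card_matches_recursion[OF finite_deck deck_ne[OF n] card_deck_same_rank, where s = r]
        by (intro divide_right_mono) (simp_all only: c_def card_deck fact_ge_zero)
      also have "\<dots> = c / real (k * n)"
        by (simp only: fact_reduce[OF N]) simp
      also have "\<dots> \<le> c / real n"
        using n assms by (intro divide_left_mono) (auto simp: c_def)
      finally show ?thesis .
    qed
    show "(\<lambda>n. real (Suc r) * pmf (p n) (Suc r) - real (k - 1) * pmf (p n) r) \<longlonglongrightarrow> 0"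
    proof (rule Lim_null_comparison)
      show "eventually (\<lambda>n. norm (real (Suc r) * pmf (p n) (Suc r) - real (k - 1) * pmf (p n) r) \<le> c / real n) sequentially"
        using eventually_gt_at_top[of 0] by eventually_elim (simp only: real_norm_def bound)
    qed (rule lim_const_over_n)
  next
    fix R :: nat assume R: "R > 0"
    show "eventually (\<lambda>n. measure_pmf.prob (p n) {R..} \<le> real (k - 1) / real R) sequentially"
      using eventually_gt_at_top[of 0]
    proof eventually_elim
      case (elim n)
      let ?P = "permutations_of_set (deck k n)"
      \<comment> \<open>Markov's inequality\<close>
      have "real R * real (card {xs \<in> ?P. R \<le> matches xs}) = (\<Sum>xs\<in>?P. real R * of_bool (R \<le> matches xs))"
        by (simp add: finite_deck Int_def flip: sum_distrib_left)
      also have "\<dots> \<le> (\<Sum>xs\<in>?P. real (matches xs))"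
        by (rule sum_mono) simp
      also have "\<dots> = real (k - 1) * fact (k * n)"
        using sum_matches_permutations[OF finite_deck deck_ne[OF elim] card_deck_same_rank]
        by (simp add: card_deck)
      finally have "real (card {xs \<in> ?P. R \<le> matches xs}) / fact (k * n) \<le> real (k - 1) / real R"
        using R by (simp add: field_simps)
      then show ?case
        by (simp add: p_def vimage_def flip: prob_shuffled_deck)
    qed
  qed
  then show "(\<lambda>n. measure_pmf.prob (shuffled_deck k n) {xs. matches xs = r})
           \<longlonglongrightarrow> exp (- (real k - 1)) * (real k - 1) ^ r / fact r"
    by (simp only: pmf_p k)
qed

end
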